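(* For every $k\ge 3$ and every $n\ge 3$, every connected $n$-vertex (not necessarily non-homotopic) $k^+$-real face graph has at most $\frac{k}{k-2}(n-2)$ edges.
   Context: Graphs are finite and have no loops, but may have parallel edges. A drawing on the sphere $\mathbb{S}^2$ maps vertices to pairwise distinct points and each edge to a simple Jordan arc joining its endpoints, such that no edge passes through a vertex, any two edges have finitely many common points, every common interior point of two edges is a proper crossing, and no three edges pass through the same crossing. Cells are the connected components of $\mathbb{S}^2$ minus the drawing; a vertex-incidence of a cell is an appearance of a vertex on its boundary (counted with repetitions). A drawing is $k^+$-real face if every cell has at least $k$ vertex-incidences, and a $k^+$-real face graph is a graph admitting such a drawing. *)

theory Defs
  imports "HOL-Analysis.Analysis"
begin

definition multigraph :: "'v set \<Rightarrow> 'e set \<Rightarrow> ('e \<Rightarrow> 'v set) \<Rightarrow> bool" where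
  "multigraph V E ends \<longleftrightarrow> finite V \<and> finite E \<and>
     (\<forall>e\<in>E. ends e \<subseteq> V \<and> card (ends e) = 2)"

definition adjacent :: "'e set \<Rightarrow> ('e \<Rightarrow> 'v set) \<Rightarrow> 'v \<Rightarrow> 'v \<Rightarrow> bool" where
  "adjacent E ends u v \<longleftrightarrow> (\<exists>e\<in>E. ends e = {u, v})"

definition graph_connected :: "'v set \<Rightarrow> 'e set \<Rightarrow> ('e \<Rightarrow> 'v set) \<Rightarrow> bool" where
  "graph_connected V E ends \<longleftrightarrow> V \<noteq> {} \<and>
     (\<forall>u\<in>V. \<forall>v\<in>V. (adjacent E ends)\<^sup>*\<^sup>* u v)"

abbreviation S2 :: "(real^3) set" where
  "S2 \<equiv> sphere 0 1"

definition interior_pts :: "(real \<Rightarrow> real^3) \<Rightarrow> (real^3) set" where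
  "interior_pts g = g ` {0<..<1}"

definition proper_crossing :: "(real \<Rightarrow> real^3) \<Rightarrow> (real \<Rightarrow> real^3) \<Rightarrow> real^3 \<Rightarrow> bool" where
  "proper_crossing g h p \<longleftrightarrow>
     (\<exists>U \<phi> \<psi>. openin (top_of_set S2) U \<and> p \<in> U \<and>
        homeomorphism U (ball (0::complex) 1) \<phi> \<psi> \<and> \<phi> p = 0 \<and>
        \<phi> ` (U \<inter> path_image g) = {z \<in> ball 0 1. Im z = 0} \<and>
        \<phi> ` (U \<inter> path_image h) = {z \<in> ball 0 1. Re z = 0})"

definition drawing ::
  "'v set \<Rightarrow> 'e set \<Rightarrow> ('e \<Rightarrow> 'v set) \<Rightarrow> ('v \<Rightarrow> real^3) \<Rightarrow> ('e \<Rightarrow> real \<Rightarrow> real^3) \<Rightarrow> bool" where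
  "drawing V E ends pos \<gamma> \<longleftrightarrow>
     inj_on pos V \<and> pos ` V \<subseteq> S2 \<and>
     (\<forall>e\<in>E. arc (\<gamma> e) \<and> path_image (\<gamma> e) \<subseteq> S2 \<and>
              {pathstart (\<gamma> e), pathfinish (\<gamma> e)} = pos ` ends e) \<and>
     (\<forall>e\<in>E. interior_pts (\<gamma> e) \<inter> pos ` V = {}) \<and>
     (\<forall>e\<in>E. \<forall>f\<in>E. e \<noteq> f \<longrightarrow> finite (path_image (\<gamma> e) \<inter> path_image (\<gamma> f))) \<and>
     (\<forall>e\<in>E. \<forall>f\<in>E. e \<noteq> f \<longrightarrow>
        (\<forall>p \<in> interior_pts (\<gamma> e) \<inter> interior_pts (\<gamma> f). proper_crossing (\<gamma> e) (\<gamma> f) p)) \<and>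
     (\<forall>e\<in>E. \<forall>f\<in>E. \<forall>g\<in>E. e \<noteq> f \<and> e \<noteq> g \<and> f \<noteq> g \<longrightarrow>
        path_image (\<gamma> e) \<inter> path_image (\<gamma> f) \<inter> path_image (\<gamma> g) \<subseteq> pos ` V)"

definition drawing_set :: "'v set \<Rightarrow> 'e set \<Rightarrow> ('v \<Rightarrow> real^3) \<Rightarrow> ('e \<Rightarrow> real \<Rightarrow> real^3) \<Rightarrow> (real^3) set" where
  "drawing_set V E pos \<gamma> = pos ` V \<union> (\<Union>e\<in>E. path_image (\<gamma> e))"

definition cells :: "'v set \<Rightarrow> 'e set \<Rightarrow> ('v \<Rightarrow> real^3) \<Rightarrow> ('e \<Rightarrow> real \<Rightarrow> real^3) \<Rightarrow> (real^3) set set" where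
  "cells V E pos \<gamma> = components (S2 - drawing_set V E pos \<gamma>)"

text \<open>Appearances of vertex v on the boundary of cell c, counted with repetitions, seen at
  scale eps: the number of components of (small spherical cap around v) minus the drawing
  which lie in c and have v in their closure (the corners of c at v).\<close>

definition corners_at ::
  "'v set \<Rightarrow> 'e set \<Rightarrow> ('v \<Rightarrow> real^3) \<Rightarrow> ('e \<Rightarrow> real \<Rightarrow> real^3) \<Rightarrow> (real^3) set \<Rightarrow> 'v \<Rightarrow> real \<Rightarrow> nat" where
  "corners_at V E pos \<gamma> c v \<epsilon> =
     card {K \<in> components ((S2 \<inter> ball (pos v) \<epsilon>) - drawing_set V E pos \<gamma>).
             K \<subseteq> c \<and> pos v \<in> closure K}"

definition vertex_incidences ::
  "'v set \<Rightarrow> 'e set \<Rightarrow> ('v \<Rightarrow> real^3) \<Rightarrow> ('e \<Rightarrow> real \<Rightarrow> real^3) \<Rightarrow> (real^3) set \<Rightarrow> real \<Rightarrow> nat" where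
  "vertex_incidences V E pos \<gamma> c \<epsilon> = (\<Sum>v\<in>V. corners_at V E pos \<gamma> c v \<epsilon>)"

definition kplus_real_face_drawing ::
  "nat \<Rightarrow> 'v set \<Rightarrow> 'e set \<Rightarrow> ('e \<Rightarrow> 'v set) \<Rightarrow> ('v \<Rightarrow> real^3) \<Rightarrow> ('e \<Rightarrow> real \<Rightarrow> real^3) \<Rightarrow> bool" where
  "kplus_real_face_drawing k V E ends pos \<gamma> \<longleftrightarrow>
     drawing V E ends pos \<gamma> \<and>
     (\<forall>c \<in> cells V E pos \<gamma>.
        eventually (\<lambda>\<epsilon>. k \<le> vertex_incidences V E pos \<gamma> c \<epsilon>) (at_right 0))"

definition kplus_real_face_graph :: "nat \<Rightarrow> 'v set \<Rightarrow> 'e set \<Rightarrow> ('e \<Rightarrow> 'v set) \<Rightarrow> bool" where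
  "kplus_real_face_graph k V E ends \<longleftrightarrow>
     multigraph V E ends \<and> (\<exists>pos \<gamma>. kplus_real_face_drawing k V E ends pos \<gamma>)"

end

theory Submission
  imports Defs
begin

text \<open>Let \<open>m\<close> be the number of edges. Adding the edges one by one so that the drawing stays
  connected, every edge that does not reach a new vertex splits a component of the complement: it
  closes up, through the part already drawn, to a Jordan curve. So there are at least \<open>m - n + 2\<close>
  cells. Around a vertex the drawing consists of \<open>deg v\<close> arcs up to their first exit from a small
  disc, and these cut the disc into \<open>deg v\<close> sectors; parts of arcs that return to the disc stay
  away from the vertex. So there are at most \<open>2 m\<close> vertex-incidences, and \<open>k (m - n + 2) \<le> 2 m\<close>.
  Crossings only create more cells and can be ignored.

  Everything except the final count takes place in the plane, which is the sphere without a point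
  off the drawing. The arcs may be wild, but Janiszewski's theorem and the Jordan curve theorem
  need no regularity.\<close>

section \<open>Components after removing a subset of one component\<close>

lemma components_Diff_subset_component:
  assumes C: "C \<in> components U" and B: "B \<subseteq> C"
  shows "components (U - B) = (components U - {C}) \<union> components (C - B)"
proof -
  have C_subset: "C \<subseteq> U" using C by (rule in_components_subset)
  have C_eq: "connected_component_set U x = C" if "x \<in> C" for x
    using that C by (metis components_iff connected_component_eq)
  have inside_C: "connected_component_set (U - B) x = connected_component_set (C - B) x"
    if x: "x \<in> C - B" for x
  proof
    have "connected_component_set (U - B) x \<subseteq> C - B"
      using connected_component_mono[of "U - B" U x] connected_component_subset[of "U - B" x] C_eq x
      by blast
    then show "connected_component_set (U - B) x \<subseteq> connected_component_set (C - B) x"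
      using x C_subset by (intro connected_component_maximal) auto
    show "connected_component_set (C - B) x \<subseteq> connected_component_set (U - B) x"
      using C_subset by (intro connected_component_mono) auto
  qed
  have in_C_iff: "connected_component_set U x = C \<longleftrightarrow> x \<in> C" if "x \<in> U" for x
    using that C_eq by (metis connected_component_refl mem_Collect_eq)
  have outside_C: "connected_component_set (U - B) x = connected_component_set U x"
    if x: "x \<in> U - C" for x
  proof
    have "connected_component_set U x \<in> components U" using x by (auto intro: componentsI)
    then have "connected_component_set U x \<inter> C = {}"
      using components_nonoverlap[OF _ C] in_C_iff x by blast
    then have "connected_component_set U x \<subseteq> U - B"
      using B connected_component_subset[of U x] by blast
    then show "connected_component_set U x \<subseteq> connected_component_set (U - B) x"
      using x by (intro connected_component_maximal) auto
  qed (intro connected_component_mono Diff_subset)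
  have "components U - {C} = connected_component_set U ` (U - C)"
    using in_C_iff unfolding components_def by blast
  moreover have "U - B = (C - B) \<union> (U - C)" using B C_subset by blast
  moreover have "connected_component_set (U - B) ` (C - B) = components (C - B)"
    "connected_component_set (U - B) ` (U - C) = connected_component_set U ` (U - C)"
    using inside_C outside_C unfolding components_def by (auto cong: image_cong_simp)
  ultimately show ?thesis
    unfolding components_def[of "U - B"] by (simp only: image_Un Un_commute)
qed

lemma finite_components_Diff_iff:
  assumes "C \<in> components U" "B \<subseteq> C" "finite (components (C - B))"
  shows "finite (components (U - B)) \<longleftrightarrow> finite (components U)"
  unfolding components_Diff_subset_component[OF assms(1,2)] using assms(3) by simp

lemma card_components_Diff:
  assumes "C \<in> components U" "B \<subseteq> C" "finite (components (C - B))" "finite (components U)"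
  shows "card (components (U - B)) + 1 = card (components U) + card (components (C - B))"
proof -
  have "K \<notin> components (C - B)" if K: "K \<in> components U" "K \<noteq> C" for K
  proof
    assume "K \<in> components (C - B)"
    then have "K \<subseteq> C" "K \<noteq> {}"
      using in_components_subset in_components_nonempty by blast+
    then show False using components_nonoverlap[OF K(1) assms(1)] K(2) by blast
  qed
  then have "(components U - {C}) \<inter> components (C - B) = {}" by blast
  then have "card (components (U - B)) = card (components U - {C}) + card (components (C - B))"
    unfolding components_Diff_subset_component[OF assms(1,2)] using assms(3,4)
    by (intro card_Un_disjoint) auto
  then show ?thesis using card_Suc_Diff1[OF assms(4,1)] by simp
qed

section \<open>Adding an arc to a closed set in the plane\<close>

lemma Janiszewski_connected_Int_components:
  fixes S J :: "complex set"
  assumes S: "closed S" and J: "compact J" and conn: "connected (S \<inter> J)"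
    and C: "C \<in> components (- S)" and D: "D \<in> components (- J)"
  shows "connected (C \<inter> D)"
  unfolding connected_iff_connected_component
proof (intro ballI)
  fix x y assume xy: "x \<in> C \<inter> D" "y \<in> C \<inter> D"
  have "connected_component (- S) x y"
    using xy C by (meson IntD1 connected_component_of_subset connected_iff_connected_component
        in_components_connected in_components_subset)
  moreover have "connected_component (- J) x y"
    using xy D by (meson IntD2 connected_component_of_subset connected_iff_connected_component
        in_components_connected in_components_subset)
  ultimately have "connected_component (- (J \<union> S)) x y"
    using Janiszewski[OF J S] conn by (simp add: Int_commute)
  then obtain K where K: "connected K" "K \<subseteq> - (J \<union> S)" "x \<in> K" "y \<in> K"
    unfolding connected_component_def by blast
  have "K \<subseteq> C \<inter> D"
    using components_maximal[OF C K(1)] components_maximal[OF D K(1)] K(2,3) xy(1) by blast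
  then show "connected_component (C \<inter> D) x y"
    using K unfolding connected_component_def by blast
qed

definition chord :: "'a::topological_space set \<Rightarrow> (real \<Rightarrow> 'a) \<Rightarrow> bool" where
  "chord S g \<longleftrightarrow> arc g \<and> S \<inter> path_image g = {pathstart g, pathfinish g}"

lemma chordD:
  assumes "chord S g"
  shows "arc g" "S \<inter> path_image g = {pathstart g, pathfinish g}"
  using assms by (simp_all add: chord_def)

lemma closed_Un_chord:
  fixes S :: "'a::t2_space set"
  shows "closed S \<Longrightarrow> chord S g \<Longrightarrow> closed (S \<union> path_image g)"
  by (intro closed_Un closed_arc_image chordD(1))

lemma path_connected_Un_chord:
  assumes "path_connected S" "chord S g"
  shows "path_connected (S \<union> path_image g)"
proof (rule path_connected_Un)
  show "path_connected (path_image g)"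
    using chordD(1)[OF assms(2)] by (intro path_connected_path_image arc_imp_path)
  show "S \<inter> path_image g \<noteq> {}"
    unfolding chordD(2)[OF assms(2)] by simp
qed (rule assms(1))

lemma chord_extends_to_simple_loop:
  fixes S :: "'a::{complete_space,real_normed_vector} set"
  assumes S: "path_connected S" and chord: "chord S g"
  obtains c where "simple_path c" "pathfinish c = pathstart c" "path_image g \<subseteq> path_image c"
    "path_image c \<subseteq> S \<union> path_image g" "connected (S \<inter> path_image c)"
proof -
  note g = chordD[OF chord]
  have ends: "pathfinish g \<in> S" "pathstart g \<in> S" "pathfinish g \<noteq> pathstart g"
    using g(2) arc_distinct_ends[OF g(1)] by auto
  then obtain b where b: "arc b" "path_image b \<subseteq> S"
    "pathstart b = pathfinish g" "pathfinish b = pathstart g"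
    using S[unfolded path_connected_arcwise, rule_format, OF ends] by blast
  have image: "path_image (g +++ b) = path_image g \<union> path_image b"
    using b(3) by (simp add: path_image_join)
  have "{pathstart g, pathfinish g} \<subseteq> path_image b"
    using pathstart_in_path_image[of b] pathfinish_in_path_image[of b] b(3,4) by simp
  then have "S \<inter> path_image (g +++ b) = path_image b"
    using b(2) unfolding image Int_Un_distrib g(2) by blast
  then have "connected (S \<inter> path_image (g +++ b))"
    using connected_path_image[OF arc_imp_path[OF b(1)]] by simp
  moreover have "simple_path (g +++ b)"
    using g b by (intro simple_path_join_loop) auto
  ultimately show thesis
    using that[of "g +++ b"] image b by auto
qed

lemma Jordan_curve_side:
  fixes c :: "real \<Rightarrow> complex"
  assumes "simple_path c" "pathfinish c = pathstart c"
    and "D = inside (path_image c) \<or> D = outside (path_image c)"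
  shows "D \<in> components (- path_image c)" "open D" "frontier D = path_image c"
proof -
  have "connected D \<and> D \<noteq> {} \<and> open D \<and> frontier D = path_image c"
    using Jordan_inside_outside[OF assms(1,2)] assms(3) by metis
  then show "D \<in> components (- path_image c)" "open D" "frontier D = path_image c"
    using assms(3) inside_in_components[of "path_image c"] outside_in_components[of "path_image c"]
    by metis+
qed

text \<open>The loop formed by the chord and an arc in \<open>S\<close> has an inside and an outside, and both meet
  every neighbourhood of an interior point of the chord. By Janiszewski's theorem neither part of
  the component is separated further.\<close>

lemma card_components_Diff_chord:
  fixes S :: "complex set"
  assumes S: "closed S" "path_connected S" and chord: "chord S g"
    and C: "C \<in> components (- S)" and interior: "path_image g - {pathstart g, pathfinish g} \<subseteq> C"
  shows "card (components (C - path_image g)) = 2"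
proof -
  obtain c where c: "simple_path c" "pathfinish c = pathstart c" "path_image g \<subseteq> path_image c"
    "path_image c \<subseteq> S \<union> path_image g" "connected (S \<inter> path_image c)"
    using chord_extends_to_simple_loop[OF S(2) chord] .
  let ?in = "inside (path_image c)" and ?out = "outside (path_image c)"
  have "path_image g - {pathstart g, pathfinish g} \<noteq> {}"
    using simple_path_endless[OF arc_imp_simple_path[OF chordD(1)[OF chord]]] by simp
  then obtain m where m: "m \<in> path_image g" "m \<in> C" using interior by fast
  have "open C" by (rule open_components[OF open_Compl[OF S(1)] C])
  have part: "open (C \<inter> D) \<and> connected (C \<inter> D) \<and> C \<inter> D \<noteq> {}"
    if "D = ?in \<or> D = ?out" for D
  proof (intro conjI)
    note D = Jordan_curve_side[OF c(1,2) that]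
    show "open (C \<inter> D)" using \<open>open C\<close> D(2) by (rule open_Int)
    show "connected (C \<inter> D)"
      by (rule Janiszewski_connected_Int_components
          [OF S(1) compact_simple_path_image[OF c(1)] c(5) C D(1)])
    have "m \<in> C \<inter> closure D" using m c(3) D(3) by (auto simp: frontier_def)
    then show "C \<inter> D \<noteq> {}" using open_Int_closure_eq_empty[OF \<open>open C\<close>] by blast
  qed
  note parts = part[OF disjI1[OF refl]] part[OF disjI2[OF refl]]
  have disjoint: "(C \<inter> ?in) \<inter> (C \<inter> ?out) = {}"
    using inside_Int_outside[of "path_image c"] by fast
  have "C - path_image g = C \<inter> - path_image c"
    using c(3,4) in_components_subset[OF C] by fast
  also have "\<dots> = (C \<inter> ?in) \<union> (C \<inter> ?out)"
    by (simp only: Int_Un_distrib[symmetric] inside_Un_outside)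
  finally have "components (C - path_image g) = {C \<inter> ?in, C \<inter> ?out}"
    using parts disjoint by (intro components_open_unique) (auto simp: pairwise_insert disjnt_def)
  moreover have "C \<inter> ?in \<noteq> C \<inter> ?out" using parts disjoint by auto
  ultimately show ?thesis by simp
qed

lemma card_components_Un_chord:
  fixes S :: "complex set"
  assumes S: "closed S" "path_connected S" and chord: "chord S g"
    and fin: "finite (components (- S))"
  shows "finite (components (- (S \<union> path_image g)))"
    and "card (components (- (S \<union> path_image g))) = Suc (card (components (- S)))"
proof -
  let ?B = "path_image g - {pathstart g, pathfinish g}"
  note Sg = chordD(2)[OF chord] and simple = arc_imp_simple_path[OF chordD(1)[OF chord]]
  have "?B \<subseteq> - S" using Sg by blast
  moreover have "?B \<noteq> {}" using simple_path_endless[OF simple] by simp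
  ultimately obtain C where C: "C \<in> components (- S)" "?B \<subseteq> C"
    using exists_component_superset[of ?B "- S"] connected_simple_path_endless[OF simple] by blast
  have "C - ?B = C - path_image g"
    using Sg in_components_subset[OF C(1)] by auto
  then have two_parts: "card (components (C - ?B)) = 2"
    using card_components_Diff_chord[OF S chord C] by simp
  then have "finite (components (C - ?B))"
    by (simp add: card_ge_0_finite)
  moreover have "- S - ?B = - (S \<union> path_image g)" using Sg by auto
  ultimately show "finite (components (- (S \<union> path_image g)))"
    "card (components (- (S \<union> path_image g))) = Suc (card (components (- S)))"
    using finite_components_Diff_iff[OF C] card_components_Diff[OF C _ fin] fin two_parts by simp_all
qed

lemma component_not_subset_arc:
  fixes S :: "'a::euclidean_space set"
  assumes dim: "2 \<le> DIM('a)" and S: "closed S" and g: "arc g" and Sg: "S \<inter> path_image g = {p}"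
    and C: "C \<in> components (- S)"
  shows "\<not> C \<subseteq> path_image g"
proof
  assume Cg: "C \<subseteq> path_image g"
  then have "closure C \<subseteq> path_image g"
    by (simp add: closed_arc_image closure_minimal g)
  moreover have "frontier C \<subseteq> S"
    using frontier_of_components_closed_complement[OF S C] .
  ultimately have "frontier C \<subseteq> {p}"
    using Sg by (auto simp: frontier_def)
  then have "- {p} \<inter> frontier C = {}" by blast
  moreover have "- {p} \<inter> C \<noteq> {}"
    using in_components_nonempty[OF C] in_components_subset[OF C] Sg by blast
  ultimately have "- {p} - C = {}"
    using connected_Int_frontier[OF connected_punctured_universe[OF dim, of p], of C] by auto
  then have "- path_image g \<subseteq> {p}" using Cg by blast
  then have "bounded (- path_image g)"
    by (rule bounded_subset[rotated]) simp
  then show False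
    by (metis bounded_arc_image cobounded_imp_unbounded g)
qed

lemma connected_arc_delete_pathstart:
  assumes "arc g"
  shows "connected (path_image g - {pathstart g})"
proof -
  have inj: "inj_on g {0..1}" and cont: "continuous_on {0..1} g"
    using assms by (simp_all add: arc_def path_def)
  have "{0<..1} = {0..1} - {0 :: real}" by auto
  then have "path_image g - {pathstart g} = g ` {0<..1}"
    using inj_on_image_set_diff[OF inj, of "{0..1}" "{0}"] by (simp add: path_image_def pathstart_def)
  moreover have "continuous_on {0<..1} g"
    by (rule continuous_on_subset[OF cont]) auto
  ultimately show ?thesis
    by (simp add: connected_continuous_image)
qed

lemma card_components_Un_dangling_arc:
  fixes S :: "complex set"
  assumes S: "closed S" and g: "arc g" and Sg: "S \<inter> path_image g = {pathstart g}"
    and fin: "finite (components (- S))"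
  shows "finite (components (- (S \<union> path_image g)))"
    and "card (components (- (S \<union> path_image g))) = card (components (- S))"
proof -
  let ?B = "path_image g - {pathstart g}"
  have "pathfinish g \<in> ?B" using arc_distinct_ends[OF g] by auto
  moreover have "?B \<subseteq> - S" using Sg by blast
  ultimately obtain C where C: "C \<in> components (- S)" "?B \<subseteq> C"
    using exists_component_superset[OF _ _ connected_arc_delete_pathstart[OF g], of "- S"] by blast
  have remaining: "C - ?B = C \<inter> - path_image g"
    using Sg in_components_subset[OF C(1)] by auto
  have nonempty: "C - ?B \<noteq> {}"
    unfolding remaining using component_not_subset_arc[OF _ S g Sg C(1)] by auto
  moreover have "connected (C - ?B)"
    unfolding remaining
  proof (rule Janiszewski_connected_Int_components[OF S _ _ C(1)])
    show "compact (path_image g)" using arc_imp_path[OF g] by (rule compact_path_image)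
    show "connected (S \<inter> path_image g)" unfolding Sg by simp
    have "connected (- path_image g)" by (rule connected_arc_complement[OF g]) simp
    moreover have "- path_image g \<noteq> {}" using nonempty unfolding remaining by blast
    ultimately have "components (- path_image g) = {- path_image g}"
      by (metis components_eq_sing_iff)
    then show "- path_image g \<in> components (- path_image g)" by simp
  qed
  ultimately have "components (C - ?B) = {C - ?B}"
    by (metis components_eq_sing_iff)
  moreover have "- S - ?B = - (S \<union> path_image g)" using Sg by auto
  ultimately show "finite (components (- (S \<union> path_image g)))"
    "card (components (- (S \<union> path_image g))) = card (components (- S))"
    using finite_components_Diff_iff[OF C] card_components_Diff[OF C _ fin] fin by simp_all
qed

lemma
  fixes g :: "real \<Rightarrow> 'a::real_normed_vector"
  assumes g: "arc g" and t: "0 \<le> t" "t \<le> 1"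
  shows path_image_subpath_Un: "path_image (subpath 0 t g) \<union> path_image (subpath t 1 g) = path_image g"
    and path_image_subpath_Int: "path_image (subpath 0 t g) \<inter> path_image (subpath t 1 g) = {g t}"
proof -
  have inj: "inj_on g {0..1}" using g by (simp add: arc_def)
  have "{0..t} \<union> {t..1} = {0..1}" using t by auto
  then have "g ` {0..t} \<union> g ` {t..1} = path_image g" by (metis image_Un path_image_def)
  then show "path_image (subpath 0 t g) \<union> path_image (subpath t 1 g) = path_image g"
    using t by (simp add: path_image_subpath)
  have "g ` ({0..t} \<inter> {t..1}) = g ` {0..t} \<inter> g ` {t..1}"
    using t by (intro inj_on_image_Int[OF inj]) auto
  moreover have "{0..t} \<inter> {t..1} = {t}" using t by auto
  ultimately show "path_image (subpath 0 t g) \<inter> path_image (subpath t 1 g) = {g t}"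
    using t by (simp add: path_image_subpath)
qed

lemma arc_first_return:
  fixes g :: "real \<Rightarrow> 'a::real_normed_vector"
  assumes g: "arc g" and start: "pathstart g \<in> S" and fin: "finite (S \<inter> path_image g)"
    and more: "S \<inter> path_image g \<noteq> {pathstart g}"
  obtains t where "0 < t" "t \<le> 1" "chord S (subpath 0 t g)"
proof -
  have inj: "inj_on g {0..1}" using g by (simp add: arc_def)
  define Z where "Z = {t \<in> {0<..1}. g t \<in> S}"
  have "finite Z"
  proof (rule finite_imageD)
    show "finite (g ` Z)"
      by (rule finite_subset[OF _ fin]) (auto simp: Z_def path_image_def)
    show "inj_on g Z" by (rule inj_on_subset[OF inj]) (auto simp: Z_def)
  qed
  obtain x where x: "x \<in> S" "x \<in> path_image g" "x \<noteq> pathstart g"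
    using start more pathstart_in_path_image[of g] by blast
  then obtain s where s: "s \<in> {0..1}" "x = g s" by (auto simp: path_image_def)
  then have "s \<noteq> 0" using x(3) by (auto simp: pathstart_def)
  then have "s \<in> Z" using s x(1) by (auto simp: Z_def)
  then have "Z \<noteq> {}" by blast
  define t where "t = Min Z"
  have t: "0 < t" "t \<le> 1" "g t \<in> S"
    using Min_in[OF \<open>finite Z\<close> \<open>Z \<noteq> {}\<close>] by (auto simp: t_def Z_def)
  have before_t: "g s \<notin> S" if "0 < s" "s < t" for s
    using that Min_le[OF \<open>finite Z\<close>, of s] t(2) by (force simp: t_def Z_def)
  have "{0..t} = {0, t} \<union> {0<..<t}" using t(1) by auto
  then have "g ` {0..t} = {g 0, g t} \<union> g ` {0<..<t}" by (simp add: image_Un)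
  moreover have "S \<inter> g ` {0<..<t} = {}" using before_t by auto
  ultimately have "S \<inter> path_image (subpath 0 t g) = {g 0, g t}"
    using t start by (simp add: path_image_subpath pathstart_def Int_Un_distrib)
  then have "chord S (subpath 0 t g)"
    using t(1,2) by (simp add: chord_def arc_subpath_arc[OF g])
  then show thesis using that t(1,2) by blast
qed

lemma arc_after_first_return:
  fixes g :: "real \<Rightarrow> 'a::real_normed_vector"
  assumes g: "arc g" and t: "0 < t" "t < 1" and chord: "chord S (subpath 0 t g)"
  defines "S' \<equiv> S \<union> path_image (subpath 0 t g)"
  shows "arc (subpath t 1 g)" "g t \<in> S'"
    and "S' \<union> path_image (subpath t 1 g) = S \<union> path_image g"
    and "S' \<inter> path_image (subpath t 1 g) \<subset> S \<inter> path_image g"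
proof -
  have ends: "S \<inter> path_image (subpath 0 t g) = {g 0, g t}"
    using chordD(2)[OF chord] by simp
  show "arc (subpath t 1 g)" using t by (intro arc_subpath_arc[OF g]) auto
  show "g t \<in> S'" using ends unfolding S'_def by blast
  have image: "path_image (subpath 0 t g) \<union> path_image (subpath t 1 g) = path_image g"
      "path_image (subpath 0 t g) \<inter> path_image (subpath t 1 g) = {g t}"
    using path_image_subpath_Un[OF g] path_image_subpath_Int[OF g] t(1,2) by simp_all
  then show "S' \<union> path_image (subpath t 1 g) = S \<union> path_image g"
    unfolding S'_def Un_assoc by simp
  have "g 0 \<noteq> g t"
    using inj_onD[of g "{0..1}" 0 t] g t(1,2) by (auto simp: arc_def)
  then have "g 0 \<notin> path_image (subpath t 1 g)" using ends image(2) by blast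
  moreover have "S' \<inter> path_image (subpath t 1 g) = S \<inter> path_image (subpath t 1 g)"
    using ends image(2) unfolding S'_def by blast
  ultimately show "S' \<inter> path_image (subpath t 1 g) \<subset> S \<inter> path_image g"
    using ends image(1) by blast
qed

lemma card_components_Un_arc:
  fixes S :: "complex set"
  assumes "closed S" "path_connected S" "arc g" "pathstart g \<in> S"
    and "finite (S \<inter> path_image g)" "finite (components (- S))"
  shows "finite (components (- (S \<union> path_image g))) \<and>
    card (components (- S)) + (if pathfinish g \<in> S then 1 else 0)
      \<le> card (components (- (S \<union> path_image g)))"
  using assms
proof (induction "card (S \<inter> path_image g)" arbitrary: S g rule: less_induct)
  case less
  note S = \<open>closed S\<close> \<open>path_connected S\<close> and g = \<open>arc g\<close>
  show ?case
  proof (cases "S \<inter> path_image g = {pathstart g}")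
    case True
    then have "pathfinish g \<notin> S"
      using arc_distinct_ends[OF g] pathfinish_in_path_image[of g] by auto
    then show ?thesis
      using card_components_Un_dangling_arc[OF S(1) g True less.prems(6)] by simp
  next
    case False
    obtain t where t: "0 < t" "t \<le> 1" and chord: "chord S (subpath 0 t g)"
      by (rule arc_first_return[OF g less.prems(4,5) False])
    define S' where "S' = S \<union> path_image (subpath 0 t g)"
    have S': "closed S'" "path_connected S'" "finite (components (- S'))"
      "card (components (- S')) = Suc (card (components (- S)))"
      unfolding S'_def using closed_Un_chord[OF S(1) chord] path_connected_Un_chord[OF S(2) chord]
        card_components_Un_chord[OF S chord less.prems(6)] by simp_all
    show ?thesis
    proof (cases "t = 1")
      case True
      then show ?thesis using S'(3,4) by (simp add: S'_def)
    next
      case False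
      then have rest: "arc (subpath t 1 g)" "g t \<in> S'"
        "S' \<union> path_image (subpath t 1 g) = S \<union> path_image g"
        "S' \<inter> path_image (subpath t 1 g) \<subset> S \<inter> path_image g"
        unfolding S'_def using arc_after_first_return[OF g t(1) _ chord] t(2) by simp_all
      then have "card (S' \<inter> path_image (subpath t 1 g)) < card (S \<inter> path_image g)"
        "finite (S' \<inter> path_image (subpath t 1 g))"
        using less.prems(5) by (auto intro: psubset_card_mono finite_subset)
      then have "finite (components (- (S \<union> path_image g))) \<and>
        card (components (- S')) + (if g 1 \<in> S' then 1 else 0)
          \<le> card (components (- (S \<union> path_image g)))"
        using less.hyps[of S' "subpath t 1 g"] S'(1-3) rest(1,2) unfolding rest(3) by simp
      then show ?thesis using S'(4) by auto
    qed
  qed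
qed

section \<open>Corners at the common start of several arcs\<close>

definition corners :: "'a::topological_space set \<Rightarrow> 'a set \<Rightarrow> 'a \<Rightarrow> 'a set set" where
  "corners U D v = {K \<in> components (U - D). v \<in> closure K}"

lemma card_corners_le_card_components:
  assumes W: "open W" "v \<in> W" "W \<inter> (U - D) \<subseteq> B"
    and refine: "\<And>x y. \<lbrakk>x \<in> W; y \<in> W; connected_component B x y\<rbrakk> \<Longrightarrow> connected_component (U - D) x y"
    and fin: "finite (components B)"
  shows "finite (corners U D v) \<and> card (corners U D v) \<le> card (components B)"
proof -
  have "\<exists>x. x \<in> K \<and> x \<in> W" if "K \<in> corners U D v" for K
    using that W(1,2) open_Int_closure_eq_empty[OF W(1), of K] unfolding corners_def by blast
  then obtain a where a: "\<And>K. K \<in> corners U D v \<Longrightarrow> a K \<in> K" "\<And>K. K \<in> corners U D v \<Longrightarrow> a K \<in> W"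
    by metis
  have comp: "K \<in> components (U - D)" if "K \<in> corners U D v" for K
    using that by (simp add: corners_def)
  have a_in_B: "a K \<in> B" if "K \<in> corners U D v" for K
    using a[OF that] in_components_subset[OF comp[OF that]] W(3) by auto
  let ?f = "\<lambda>K. connected_component_set B (a K)"
  have "inj_on ?f (corners U D v)"
  proof (rule inj_onI)
    fix K L assume K: "K \<in> corners U D v" and L: "L \<in> corners U D v" and eq: "?f K = ?f L"
    have "connected_component B (a K) (a L)"
      using eq a_in_B[OF L] by (metis connected_component_refl mem_Collect_eq)
    then have "connected_component (U - D) (a K) (a L)"
      using refine a K L by simp
    moreover have "connected_component_set (U - D) (a M) = M" if "M \<in> corners U D v" for M
      using comp[OF that] a(1)[OF that] by (metis components_iff connected_component_eq)
    ultimately show "K = L"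
      using K L by (metis connected_component_eq mem_Collect_eq)
  qed
  moreover have "?f ` corners U D v \<subseteq> components B"
    using a_in_B by (auto intro: componentsI)
  ultimately show ?thesis
    using fin by (metis card_inj_on_le inj_on_finite)
qed

definition spokes :: "complex \<Rightarrow> real \<Rightarrow> 'i set \<Rightarrow> ('i \<Rightarrow> real \<Rightarrow> complex) \<Rightarrow> bool" where
  "spokes v r I \<alpha> \<longleftrightarrow>
     (\<forall>i\<in>I. arc (\<alpha> i) \<and> pathstart (\<alpha> i) = v \<and> pathfinish (\<alpha> i) \<notin> ball v r \<and>
       path_image (\<alpha> i) - {pathfinish (\<alpha> i)} \<subseteq> ball v r) \<and>
     (\<forall>i\<in>I. \<forall>j\<in>I. i \<noteq> j \<longrightarrow> path_image (\<alpha> i) \<inter> path_image (\<alpha> j) \<inter> ball v r \<subseteq> {v})"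

definition wheel :: "complex \<Rightarrow> real \<Rightarrow> 'i set \<Rightarrow> ('i \<Rightarrow> real \<Rightarrow> complex) \<Rightarrow> complex set" where
  "wheel v r F \<alpha> = - ball v r \<union> (\<Union>i\<in>F. path_image (\<alpha> i))"

lemma wheel_insert: "wheel v r (insert i F) \<alpha> = wheel v r F \<alpha> \<union> path_image (\<alpha> i)"
  by (auto simp: wheel_def)

lemma Compl_wheel: "- wheel v r F \<alpha> = ball v r - (\<Union>i\<in>F. path_image (\<alpha> i))"
  by (auto simp: wheel_def)

lemma spokesD:
  assumes "spokes v r I \<alpha>" "i \<in> I"
  shows "arc (\<alpha> i)" "pathstart (\<alpha> i) = v" "- ball v r \<inter> path_image (\<alpha> i) = {pathfinish (\<alpha> i)}"
proof -
  show "arc (\<alpha> i)" "pathstart (\<alpha> i) = v"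
    using assms by (simp_all add: spokes_def)
  have "pathfinish (\<alpha> i) \<notin> ball v r" "path_image (\<alpha> i) - {pathfinish (\<alpha> i)} \<subseteq> ball v r"
    using assms unfolding spokes_def by blast+
  then show "- ball v r \<inter> path_image (\<alpha> i) = {pathfinish (\<alpha> i)}"
    using pathfinish_in_path_image[of "\<alpha> i"] by blast
qed

lemma spokes_subset: "spokes v r I \<alpha> \<Longrightarrow> F \<subseteq> I \<Longrightarrow> spokes v r F \<alpha>"
  unfolding spokes_def by (meson subsetD)

lemma chord_wheel_spoke:
  assumes spokes: "spokes v r (insert j F) \<alpha>" and "F \<noteq> {}" "j \<notin> F"
  shows "chord (wheel v r F \<alpha>) (\<alpha> j)"
proof -
  have center: "v \<in> path_image (\<alpha> i)" if "i \<in> insert j F" for i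
    using spokesD(2)[OF spokes that] pathstart_in_path_image[of "\<alpha> i"] by simp
  have "path_image (\<alpha> i) \<inter> path_image (\<alpha> j) \<inter> ball v r \<subseteq> {v}" if "i \<in> F" for i
    using spokes that \<open>j \<notin> F\<close> unfolding spokes_def by (metis insertCI)
  then have "(\<Union>i\<in>F. path_image (\<alpha> i)) \<inter> path_image (\<alpha> j) \<inter> ball v r \<subseteq> {v}" by fast
  moreover have "v \<in> (\<Union>i\<in>F. path_image (\<alpha> i)) \<inter> path_image (\<alpha> j)"
    using center \<open>F \<noteq> {}\<close> by auto
  moreover have "- ball v r \<inter> path_image (\<alpha> j) = {pathfinish (\<alpha> j)}" "pathstart (\<alpha> j) = v" "arc (\<alpha> j)"
    using spokesD[OF spokes] by auto
  ultimately show ?thesis unfolding chord_def wheel_def by fast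
qed

lemma closed_path_connected_wheel:
  assumes "finite F" "spokes v r F \<alpha>"
  shows "closed (wheel v r F \<alpha>) \<and> path_connected (wheel v r F \<alpha>)"
  using assms
proof (induction rule: finite_induct)
  case empty
  have "path_connected (- ball v r)"
    by (rule path_connected_complement_bounded_convex) simp_all
  then show ?case by (simp add: wheel_def closed_Compl)
next
  case (insert i F)
  note spoke = spokesD[OF insert.prems insertI1]
  have IH: "closed (wheel v r F \<alpha>)" "path_connected (wheel v r F \<alpha>)"
    using insert.IH spokes_subset[OF insert.prems] by auto
  have "pathfinish (\<alpha> i) \<in> wheel v r F \<alpha> \<inter> path_image (\<alpha> i)"
    using spoke(3) unfolding wheel_def by fast
  then have "path_connected (wheel v r F \<alpha> \<union> path_image (\<alpha> i))"
    using IH(2) path_connected_path_image[OF arc_imp_path[OF spoke(1)]]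
    by (intro path_connected_Un) auto
  then show ?case
    using IH(1) closed_arc_image[OF spoke(1)] by (simp add: wheel_insert closed_Un)
qed

lemma card_components_Compl_wheel:
  assumes "finite I" "I \<noteq> {}" "spokes v r I \<alpha>" "0 < r"
  shows "finite (components (- wheel v r I \<alpha>)) \<and> card (components (- wheel v r I \<alpha>)) = card I"
  using assms
proof (induction rule: finite_ne_induct)
  case (singleton i)
  have "components (ball v r) = {ball v r}"
    using singleton.prems(2) by (simp add: components_eq_sing_iff)
  then show ?case
    using card_components_Un_dangling_arc[of "- ball v r" "reversepath (\<alpha> i)"]
      spokesD[OF singleton.prems(1)]
    by (simp add: wheel_def arc_reversepath closed_Compl)
next
  case (insert j F)
  have F: "spokes v r F \<alpha>" by (rule spokes_subset[OF insert.prems(1)]) auto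
  have chord: "chord (wheel v r F \<alpha>) (\<alpha> j)"
    by (rule chord_wheel_spoke[OF insert.prems(1) insert.hyps(2,3)])
  have "closed (wheel v r F \<alpha>)" "path_connected (wheel v r F \<alpha>)"
    using closed_path_connected_wheel[OF insert.hyps(1) F] by blast+
  then show ?case
    using card_components_Un_chord[OF _ _ chord] insert.IH[OF F insert.prems(2)] insert.hyps(1,3)
    by (simp add: wheel_insert)
qed

locale arc_star =
  fixes v :: complex and r :: real and I :: "'i set" and \<delta> :: "'i \<Rightarrow> real \<Rightarrow> complex"
  assumes radius_pos: "0 < r"
    and finite_I: "finite I" and I_nonempty: "I \<noteq> {}"
    and arc_ray: "i \<in> I \<Longrightarrow> arc (\<delta> i)"
    and ray_start: "i \<in> I \<Longrightarrow> pathstart (\<delta> i) = v"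
    and ray_finish: "i \<in> I \<Longrightarrow> pathfinish (\<delta> i) \<notin> ball v r"
    and rays_disjoint: "\<lbrakk>i \<in> I; j \<in> I; i \<noteq> j\<rbrakk> \<Longrightarrow>
      path_image (\<delta> i) \<inter> path_image (\<delta> j) \<inter> ball v r \<subseteq> {v}"
begin

definition exit_time :: "'i \<Rightarrow> real" where
  "exit_time i = (SOME t. 0 < t \<and> t \<le> 1 \<and> \<delta> i t \<notin> ball v r \<and>
     path_image (subpath 0 t (\<delta> i)) - {\<delta> i t} \<subseteq> ball v r)"

definition spoke :: "'i \<Rightarrow> real \<Rightarrow> complex" where
  "spoke i = subpath 0 (exit_time i) (\<delta> i)"

definition remainder :: "'i \<Rightarrow> real \<Rightarrow> complex" where
  "remainder i = subpath (exit_time i) 1 (\<delta> i)"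

lemma exit_time:
  assumes i: "i \<in> I"
  shows "0 < exit_time i" "exit_time i \<le> 1" "\<delta> i (exit_time i) \<notin> ball v r"
    "path_image (spoke i) - {\<delta> i (exit_time i)} \<subseteq> ball v r"
proof -
  have "pathstart (\<delta> i) \<in> closure (ball v r)" using ray_start[OF i] radius_pos by simp
  then obtain t where t: "0 \<le> t" "t \<le> 1" "\<delta> i t \<in> frontier (ball v r)"
    "path_image (subpath 0 t (\<delta> i)) - {\<delta> i t} \<subseteq> interior (ball v r)"
    using subpath_to_frontier[OF arc_imp_path[OF arc_ray[OF i]] _ ray_finish[OF i]] by blast
  then have "t \<noteq> 0" using ray_start[OF i] radius_pos by (auto simp: pathstart_def)
  then have "0 < t \<and> t \<le> 1 \<and> \<delta> i t \<notin> ball v r \<and> path_image (subpath 0 t (\<delta> i)) - {\<delta> i t} \<subseteq> ball v r"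
    using t radius_pos by (auto simp: interior_open)
  then have "0 < exit_time i \<and> exit_time i \<le> 1 \<and> \<delta> i (exit_time i) \<notin> ball v r \<and>
      path_image (subpath 0 (exit_time i) (\<delta> i)) - {\<delta> i (exit_time i)} \<subseteq> ball v r"
    unfolding exit_time_def by (rule someI)
  then show "0 < exit_time i" "exit_time i \<le> 1" "\<delta> i (exit_time i) \<notin> ball v r"
    "path_image (spoke i) - {\<delta> i (exit_time i)} \<subseteq> ball v r"
    unfolding spoke_def by metis+
qed

lemma spoke_remainder:
  assumes "i \<in> I"
  shows "path_image (spoke i) \<union> path_image (remainder i) = path_image (\<delta> i)"
    and "path_image (spoke i) \<inter> path_image (remainder i) = {pathfinish (spoke i)}"
  using path_image_subpath_Un[OF arc_ray[OF assms]] path_image_subpath_Int[OF arc_ray[OF assms]]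
    exit_time(1,2)[OF assms] by (simp_all add: spoke_def remainder_def)

lemma spokes_spoke: "spokes v r I spoke"
  unfolding spokes_def
proof (intro conjI ballI impI)
  fix i assume i: "i \<in> I"
  show "arc (spoke i)" "pathstart (spoke i) = v"
    using exit_time(1,2)[OF i] arc_ray[OF i] ray_start[OF i]
    by (auto simp: spoke_def pathstart_def[of "\<delta> i"] intro: arc_subpath_arc)
  show "pathfinish (spoke i) \<notin> ball v r" "path_image (spoke i) - {pathfinish (spoke i)} \<subseteq> ball v r"
    using exit_time(3,4)[OF i] unfolding spoke_def pathfinish_subpath .
  fix j assume j: "j \<in> I" "i \<noteq> j"
  show "path_image (spoke i) \<inter> path_image (spoke j) \<inter> ball v r \<subseteq> {v}"
    using rays_disjoint[OF i j] spoke_remainder(1)[OF i] spoke_remainder(1)[OF j(1)] by fast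
qed

lemma center_notin_remainder:
  assumes i: "i \<in> I"
  shows "v \<notin> path_image (remainder i)"
proof
  note spoke = spokesD[OF spokes_spoke i]
  assume "v \<in> path_image (remainder i)"
  then have "v = pathfinish (spoke i)"
    using spoke_remainder(2)[OF i] pathstart_in_path_image[of "spoke i"] spoke(2) by auto
  then show False using arc_distinct_ends[OF spoke(1)] spoke(2) by simp
qed

lemma spoke_Int_remainder:
  assumes ij: "i \<in> I" "j \<in> I"
  shows "path_image (spoke i) \<inter> path_image (remainder j) \<inter> ball v r = {}"
proof (cases "i = j")
  case True
  then show ?thesis using spoke_remainder(2)[OF ij(1)] spokesD(3)[OF spokes_spoke ij(1)] by fast
next
  case False
  then show ?thesis
    using rays_disjoint[OF ij] spoke_remainder(1)[OF ij(1)] spoke_remainder(1)[OF ij(2)]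
      center_notin_remainder[OF ij(2)] by fast
qed

definition rim :: "complex set" where
  "rim = sphere v r \<union> (\<Union>i\<in>I. path_image (remainder i) \<inter> cball v r)"

lemma compact_rim: "compact rim"
proof -
  have "compact (path_image (remainder i))" if "i \<in> I" for i
    unfolding remainder_def using arc_ray[OF that] exit_time(1,2)[OF that]
    by (intro compact_path_image path_subpath arc_imp_path) auto
  then show ?thesis
    unfolding rim_def
    by (intro compact_Un compact_UN finite_I compact_sphere compact_Int compact_cball) auto
qed

lemma rim_Int_wheel: "rim \<inter> wheel v r I spoke = sphere v r"
proof
  show "rim \<inter> wheel v r I spoke \<subseteq> sphere v r"
  proof
    fix x assume x: "x \<in> rim \<inter> wheel v r I spoke"
    show "x \<in> sphere v r"
    proof (rule ccontr)
      assume "x \<notin> sphere v r"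
      then obtain j where j: "j \<in> I" "x \<in> path_image (remainder j)" "x \<in> ball v r"
        using x by (auto simp: rim_def)
      then obtain i where "i \<in> I" "x \<in> path_image (spoke i)"
        using x by (auto simp: wheel_def)
      then show False using spoke_Int_remainder j by blast
    qed
  qed
qed (auto simp: rim_def wheel_def)

lemma rim_Un_wheel: "rim \<union> wheel v r I spoke = wheel v r I \<delta>"
proof -
  have "rim \<union> wheel v r I spoke
      = - ball v r \<union> (\<Union>i\<in>I. path_image (spoke i) \<union> path_image (remainder i))"
    unfolding rim_def wheel_def by auto
  also have "\<dots> = wheel v r I \<delta>" unfolding wheel_def by (simp add: spoke_remainder(1))
  finally show ?thesis .
qed

text \<open>An arc may return to the disc after its first exit. The returning parts stay away from the
  centre, and together with the boundary circle they meet the wheel of spokes in that circle only;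
  so, by Janiszewski's theorem, they separate no two points near the centre.\<close>

lemma connected_component_Compl_wheel_near_center:
  "\<exists>\<eta>>0. \<forall>x\<in>ball v \<eta>. \<forall>y\<in>ball v \<eta>.
    connected_component (- wheel v r I spoke) x y \<longrightarrow> connected_component (- wheel v r I \<delta>) x y"
proof -
  have "v \<notin> rim" using radius_pos center_notin_remainder by (auto simp: rim_def)
  then obtain \<eta> where \<eta>: "0 < \<eta>" "ball v \<eta> \<subseteq> - rim"
    using compact_rim by (meson ComplI compact_imp_closed open_Compl openE)
  have "connected (rim \<inter> wheel v r I spoke)"
    unfolding rim_Int_wheel by (simp add: connected_sphere)
  moreover have "closed (wheel v r I spoke)"
    using closed_path_connected_wheel[OF finite_I spokes_spoke] by blast
  moreover have "connected_component (- rim) x y" if "x \<in> ball v \<eta>" "y \<in> ball v \<eta>" for x y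
    unfolding connected_component_def using that \<eta>(2) connected_ball by metis
  ultimately have "connected_component (- wheel v r I \<delta>) x y"
    if "x \<in> ball v \<eta>" "y \<in> ball v \<eta>" "connected_component (- wheel v r I spoke) x y" for x y
    using Janiszewski[OF compact_rim, of "wheel v r I spoke"] that unfolding rim_Un_wheel by simp
  then show ?thesis using \<eta>(1) by blast
qed

lemma card_corners_le_card_rays:
  assumes U: "ball v r \<subseteq> U"
  shows "finite (corners U (\<Union>i\<in>I. path_image (\<delta> i)) v) \<and>
    card (corners U (\<Union>i\<in>I. path_image (\<delta> i)) v) \<le> card I"
proof -
  let ?D = "\<Union>i\<in>I. path_image (\<delta> i)" and ?W = "- wheel v r I spoke"
  obtain \<eta> where \<eta>: "0 < \<eta>" "\<forall>x\<in>ball v \<eta>. \<forall>y\<in>ball v \<eta>.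
      connected_component ?W x y \<longrightarrow> connected_component (- wheel v r I \<delta>) x y"
    using connected_component_Compl_wheel_near_center by blast
  note wheel = card_components_Compl_wheel[OF finite_I I_nonempty spokes_spoke radius_pos]
  have "finite (corners U ?D v) \<and> card (corners U ?D v) \<le> card (components ?W)"
  proof (rule card_corners_le_card_components)
    show "open (ball v r \<inter> ball v \<eta>)" "v \<in> ball v r \<inter> ball v \<eta>" using radius_pos \<eta>(1) by auto
    have "ball v r \<inter> ball v \<eta> \<inter> (U - ?D) \<subseteq> - wheel v r I \<delta>"
      unfolding Compl_wheel by fast
    also have "\<dots> \<subseteq> ?W" unfolding rim_Un_wheel[symmetric] by simp
    finally show "ball v r \<inter> ball v \<eta> \<inter> (U - ?D) \<subseteq> ?W" .
    show "finite (components ?W)" using wheel by blast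
    fix x y assume "x \<in> ball v r \<inter> ball v \<eta>" "y \<in> ball v r \<inter> ball v \<eta>" "connected_component ?W x y"
    then have "connected_component (- wheel v r I \<delta>) x y" using \<eta>(2) by simp
    then show "connected_component (U - ?D) x y"
      by (rule connected_component_of_subset) (use U in \<open>auto simp: Compl_wheel\<close>)
  qed
  then show ?thesis using wheel by simp
qed

end

lemma card_corners_le_card_arcs:
  fixes \<delta> :: "'i \<Rightarrow> real \<Rightarrow> complex"
  assumes I: "finite I" "I \<noteq> {}"
    and arcs: "\<And>i. i \<in> I \<Longrightarrow> arc (\<delta> i)" and start: "\<And>i. i \<in> I \<Longrightarrow> pathstart (\<delta> i) = v"
    and meet: "\<And>i j. \<lbrakk>i \<in> I; j \<in> I; i \<noteq> j\<rbrakk> \<Longrightarrow> finite (path_image (\<delta> i) \<inter> path_image (\<delta> j))"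
    and U: "open U" "v \<in> U"
  shows "finite (corners U (\<Union>i\<in>I. path_image (\<delta> i)) v) \<and>
    card (corners U (\<Union>i\<in>I. path_image (\<delta> i)) v) \<le> card I"
proof -
  define X where "X = (\<lambda>i. pathfinish (\<delta> i)) ` I \<union>
    (\<Union>i\<in>I. \<Union>j\<in>I - {i}. path_image (\<delta> i) \<inter> path_image (\<delta> j)) - {v}"
  have "finite X"
    unfolding X_def by (intro finite_Diff finite_UnI finite_imageI finite_UN_I I(1) meet) auto
  then have "open (U - X)" "v \<in> U - X"
    using U by (auto simp: X_def open_Diff finite_imp_closed)
  then obtain r where r: "0 < r" "ball v r \<subseteq> U - X" by (meson openE)
  interpret arc_star v r I \<delta>
  proof
    show "pathfinish (\<delta> i) \<notin> ball v r" if "i \<in> I" for i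
    proof -
      have "pathfinish (\<delta> i) \<noteq> v" using arc_distinct_ends[OF arcs[OF that]] start[OF that] by simp
      then have "pathfinish (\<delta> i) \<in> X" using that by (auto simp: X_def)
      then show ?thesis using r(2) by auto
    qed
    show "path_image (\<delta> i) \<inter> path_image (\<delta> j) \<inter> ball v r \<subseteq> {v}" if "i \<in> I" "j \<in> I" "i \<noteq> j" for i j
      using that r(2) unfolding X_def by fast
  qed (fact r(1) I arcs start)+
  show ?thesis using r(2) by (intro card_corners_le_card_rays) auto
qed

section \<open>Connected multigraphs\<close>

definition degree :: "'e set \<Rightarrow> ('e \<Rightarrow> 'v set) \<Rightarrow> 'v \<Rightarrow> nat" where
  "degree E ends v = card {e \<in> E. v \<in> ends e}"

lemma sum_degree:
  assumes "multigraph V E ends"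
  shows "(\<Sum>v\<in>V. degree E ends v) = 2 * card E"
  unfolding degree_def
proof (rule sum_multicount)
  show "finite V" "finite E" using assms by (auto simp: multigraph_def)
  show "\<forall>e\<in>E. card {v \<in> V. v \<in> ends e} = 2"
  proof
    fix e assume "e \<in> E"
    then have "{v \<in> V. v \<in> ends e} = ends e" "card (ends e) = 2"
      using assms by (auto simp: multigraph_def)
    then show "card {v \<in> V. v \<in> ends e} = 2" by simp
  qed
qed

lemma graph_connected_closed_set:
  assumes conn: "graph_connected V E ends" and W: "W \<subseteq> V" "W \<noteq> {}"
    and closed: "\<And>e. e \<in> E \<Longrightarrow> ends e \<inter> W \<noteq> {} \<Longrightarrow> ends e \<subseteq> W"
  shows "W = V"
proof
  show "V \<subseteq> W"
  proof
    fix u assume "u \<in> V"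
    obtain w where w: "w \<in> W" using W(2) by blast
    then have "(adjacent E ends)\<^sup>*\<^sup>* w u"
      using conn W(1) \<open>u \<in> V\<close> unfolding graph_connected_def by blast
    then show "u \<in> W"
    proof (induction rule: rtranclp_induct)
      case (step y z)
      then show ?case using closed unfolding adjacent_def by blast
    qed (rule w)
  qed
qed (rule W(1))

lemma graph_connected_incident_edge:
  assumes "graph_connected V E ends" "card V \<ge> 2" "v \<in> V"
  shows "\<exists>e\<in>E. v \<in> ends e"
proof (rule ccontr)
  assume "\<not> ?thesis"
  then have "{v} = V" using assms(3) by (intro graph_connected_closed_set[OF assms(1)]) auto
  then have "card V = 1" by (metis is_singletonI is_singleton_altdef)
  then show False using assms(2) by simp
qed

lemma graph_connected_induct:
  assumes graph: "multigraph V E ends" and conn: "graph_connected V E ends"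
    and vertex: "\<And>v. v \<in> V \<Longrightarrow> P {v} {}"
    and edge: "\<And>W F e. \<lbrakk>W \<subseteq> V; F \<subseteq> E; e \<in> E - F; ends e \<inter> W \<noteq> {}; P W F\<rbrakk> \<Longrightarrow>
      P (W \<union> ends e) (insert e F)"
  shows "P V E"
proof -
  have ends_V: "ends e \<subseteq> V" "ends e \<noteq> {}" if "e \<in> E" for e
    using graph that by (auto simp: multigraph_def)
  have "finite E" using graph by (simp add: multigraph_def)
  have "P V E"
    if "W \<subseteq> V" "W \<noteq> {}" "F \<subseteq> E" "\<And>f. f \<in> F \<Longrightarrow> ends f \<subseteq> W" "P W F" for W F
    using that
  proof (induction "card (E - F)" arbitrary: W F rule: less_induct)
    case less
    show ?case
    proof (cases "\<exists>e\<in>E - F. ends e \<inter> W \<noteq> {}")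
      case True
      then obtain e where e: "e \<in> E - F" "ends e \<inter> W \<noteq> {}" by blast
      have "card (E - insert e F) < card (E - F)"
        using e(1) \<open>finite E\<close> by (intro psubset_card_mono) auto
      then show ?thesis
      proof (rule less.hyps)
        show "P (W \<union> ends e) (insert e F)"
          by (rule edge[OF less.prems(1,3) e less.prems(5)])
        show "ends f \<subseteq> W \<union> ends e" if "f \<in> insert e F" for f
          using that less.prems(4) by blast
      qed (use less.prems(1-3) e(1) ends_V in auto)
    next
      case False
      then have "W = V"
        using less.prems(4) by (intro graph_connected_closed_set[OF conn less.prems(1,2)]) blast
      moreover from this have "F = E" using False less.prems(3) ends_V by fast
      ultimately show ?thesis using less.prems(5) by simp
    qed
  qed
  moreover obtain v where "v \<in> V" using conn by (auto simp: graph_connected_def)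
  ultimately show ?thesis using vertex[of v] by blast
qed

section \<open>Drawings by arcs\<close>

definition skeleton ::
  "'v set \<Rightarrow> 'e set \<Rightarrow> ('v \<Rightarrow> 'a) \<Rightarrow> ('e \<Rightarrow> real \<Rightarrow> 'a::topological_space) \<Rightarrow> 'a set" where
  "skeleton W F pos \<gamma> = pos ` W \<union> (\<Union>e\<in>F. path_image (\<gamma> e))"

lemma skeleton_compose: "skeleton W F (j \<circ> pos) (\<lambda>e. j \<circ> \<gamma> e) = j ` skeleton W F pos \<gamma>"
  by (simp add: skeleton_def path_image_compose image_Un image_UN image_comp)

locale arc_drawing =
  fixes V :: "'v set" and E :: "'e set" and ends :: "'e \<Rightarrow> 'v set"
    and pos :: "'v \<Rightarrow> 'a::real_normed_vector" and \<gamma> :: "'e \<Rightarrow> real \<Rightarrow> 'a"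
  assumes multigraph: "multigraph V E ends"
    and inj_pos: "inj_on pos V"
    and arc_edge: "e \<in> E \<Longrightarrow> arc (\<gamma> e)"
    and edge_ends: "e \<in> E \<Longrightarrow> {pathstart (\<gamma> e), pathfinish (\<gamma> e)} = pos ` ends e"
    and edge_avoids: "\<lbrakk>e \<in> E; v \<in> V; pos v \<in> path_image (\<gamma> e)\<rbrakk> \<Longrightarrow> v \<in> ends e"
    and finite_crossings: "\<lbrakk>e \<in> E; f \<in> E; e \<noteq> f\<rbrakk> \<Longrightarrow> finite (path_image (\<gamma> e) \<inter> path_image (\<gamma> f))"
begin

lemma finite_V: "finite V" and finite_E: "finite E"
  using multigraph by (simp_all add: multigraph_def)

lemma pos_ends_subset: "e \<in> E \<Longrightarrow> pos ` ends e \<subseteq> path_image (\<gamma> e)"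
  using edge_ends[of e, symmetric] by (simp add: pathstart_in_path_image pathfinish_in_path_image)

lemma closed_skeleton:
  assumes "W \<subseteq> V" "F \<subseteq> E"
  shows "closed (skeleton W F pos \<gamma>)"
  unfolding skeleton_def
proof (intro closed_Un closed_UN ballI)
  show "closed (pos ` W)"
    using finite_subset[OF assms(1) finite_V] by (simp add: finite_imp_closed)
  show "finite F" using finite_subset[OF assms(2) finite_E] .
  show "closed (path_image (\<gamma> e))" if "e \<in> F" for e
    using arc_edge that assms(2) by (auto intro: closed_arc_image)
qed

lemma finite_skeleton_Int_edge:
  assumes W: "W \<subseteq> V" and F: "F \<subseteq> E" and e: "e \<in> E - F"
  shows "finite (skeleton W F pos \<gamma> \<inter> path_image (\<gamma> e))"
proof -
  have "finite (\<Union>f\<in>F. path_image (\<gamma> f) \<inter> path_image (\<gamma> e))"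
    using F e by (intro finite_UN_I finite_crossings finite_subset[OF F finite_E]) auto
  moreover have "skeleton W F pos \<gamma> \<inter> path_image (\<gamma> e)
      = (pos ` W \<inter> path_image (\<gamma> e)) \<union> (\<Union>f\<in>F. path_image (\<gamma> f) \<inter> path_image (\<gamma> e))"
    unfolding skeleton_def by blast
  ultimately show ?thesis using finite_subset[OF W finite_V] by simp
qed

lemma edge_from:
  assumes e: "e \<in> E" and v: "v \<in> ends e"
  obtains g u where "arc g" "path_image g = path_image (\<gamma> e)"
    "pathstart g = pos v" "pathfinish g = pos u" "ends e = {v, u}" "u \<noteq> v"
proof -
  have "card (ends e) = 2" using multigraph e by (auto simp: multigraph_def)
  then obtain u where u: "ends e = {v, u}" "u \<noteq> v"
    using v by (metis card_2_iff doubleton_eq_iff insertE singletonD)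
  then consider "pathstart (\<gamma> e) = pos v" "pathfinish (\<gamma> e) = pos u"
    | "pathstart (\<gamma> e) = pos u" "pathfinish (\<gamma> e) = pos v"
    using edge_ends[OF e] by (auto simp: doubleton_eq_iff)
  then show thesis
  proof cases
    case 1
    then show thesis using that[of "\<gamma> e" u] arc_edge[OF e] u by simp
  next
    case 2
    then show thesis
      using that[of "reversepath (\<gamma> e)" u] arc_edge[OF e] u by (simp add: arc_reversepath)
  qed
qed

lemma arc_drawing_compose:
  fixes j :: "'a \<Rightarrow> 'b::real_normed_vector"
  assumes cont: "continuous_on (skeleton V E pos \<gamma>) j" and inj: "inj_on j (skeleton V E pos \<gamma>)"
  shows "arc_drawing V E ends (j \<circ> pos) (\<lambda>e. j \<circ> \<gamma> e)"
proof
  have edge: "path_image (\<gamma> e) \<subseteq> skeleton V E pos \<gamma>" if "e \<in> E" for e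
    using that by (auto simp: skeleton_def)
  have vertex: "pos v \<in> skeleton V E pos \<gamma>" if "v \<in> V" for v
    using that by (simp add: skeleton_def)
  show "multigraph V E ends" by (rule multigraph)
  show "inj_on (j \<circ> pos) V"
    by (intro comp_inj_on inj_pos inj_on_subset[OF inj]) (auto simp: vertex)
  fix e assume e: "e \<in> E"
  show "arc (j \<circ> \<gamma> e)"
    using arc_edge[OF e] inj_on_subset[OF inj edge[OF e]] continuous_on_subset[OF cont edge[OF e]]
    unfolding arc_def by (auto simp: path_image_def intro: path_continuous_image comp_inj_on)
  show "{pathstart (j \<circ> \<gamma> e), pathfinish (j \<circ> \<gamma> e)} = (j \<circ> pos) ` ends e"
    unfolding pathstart_compose pathfinish_compose image_comp[symmetric] edge_ends[OF e, symmetric]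
    by simp
  show "v \<in> ends e" if "v \<in> V" "(j \<circ> pos) v \<in> path_image (j \<circ> \<gamma> e)" for v
  proof -
    have "pos v \<in> path_image (\<gamma> e)"
      using that inj_on_image_mem_iff[OF inj _ edge[OF e]] vertex by (simp add: path_image_compose)
    then show ?thesis by (rule edge_avoids[OF e that(1)])
  qed
  fix f assume f: "f \<in> E" "e \<noteq> f"
  show "finite (path_image (j \<circ> \<gamma> e) \<inter> path_image (j \<circ> \<gamma> f))"
    unfolding path_image_compose inj_on_image_Int[OF inj edge[OF e] edge[OF f(1)], symmetric]
    using finite_crossings[OF e f] by simp
qed

end

locale plane_drawing = arc_drawing V E ends pos \<gamma>
  for V :: "'v set" and E :: "'e set" and ends and pos :: "'v \<Rightarrow> complex" and \<gamma>
begin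

lemma card_components_skeleton_insert_edge:
  assumes W: "W \<subseteq> V" and F: "F \<subseteq> E" and e: "e \<in> E - F" "ends e \<inter> W \<noteq> {}"
    and conn: "path_connected (skeleton W F pos \<gamma>)"
    and fin: "finite (components (- skeleton W F pos \<gamma>))"
  defines "S \<equiv> skeleton (W \<union> ends e) (insert e F) pos \<gamma>"
  shows "path_connected S" "finite (components (- S))"
    and "card (components (- skeleton W F pos \<gamma>)) + card W + 1
      \<le> card (components (- S)) + card (W \<union> ends e)"
proof -
  obtain v where v: "v \<in> ends e" "v \<in> W" using e(2) by blast
  obtain g u where g: "arc g" "path_image g = path_image (\<gamma> e)"
      "pathstart g = pos v" "pathfinish g = pos u"
    and u: "ends e = {v, u}" "u \<noteq> v"
    using edge_from[OF _ v(1)] e(1) by blast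
  have S: "S = skeleton W F pos \<gamma> \<union> path_image g"
    using pos_ends_subset[of e] e(1) unfolding S_def skeleton_def g(2) by auto
  have start: "pathstart g \<in> skeleton W F pos \<gamma>" using v(2) by (simp add: g(3) skeleton_def)
  then show "path_connected S"
    unfolding S using pathstart_in_path_image[of g]
    by (intro path_connected_Un conn path_connected_path_image arc_imp_path g(1)) blast
  have "finite (skeleton W F pos \<gamma> \<inter> path_image g)"
    unfolding g(2) by (rule finite_skeleton_Int_edge[OF W F e(1)])
  then have count: "finite (components (- S)) \<and>
      card (components (- skeleton W F pos \<gamma>)) + (if pos u \<in> skeleton W F pos \<gamma> then 1 else 0)
        \<le> card (components (- S))"
    using card_components_Un_arc[OF closed_skeleton[OF W F] conn g(1) start _ fin]
    unfolding S g(4) by simp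
  then show "finite (components (- S))" ..
  show "card (components (- skeleton W F pos \<gamma>)) + card W + 1
      \<le> card (components (- S)) + card (W \<union> ends e)"
  proof (cases "u \<in> W")
    case True
    then have "W \<union> ends e = W" "pos u \<in> skeleton W F pos \<gamma>" using u(1) v(2) by (auto simp: skeleton_def)
    then show ?thesis using count by simp
  next
    case False
    then have "card (W \<union> ends e) = Suc (card W)"
      using u(1) v(2) finite_subset[OF W finite_V] by (simp add: insert_absorb)
    then show ?thesis using count by (simp split: if_splits)
  qed
qed

lemma card_components_skeleton_lower_bound:
  assumes "graph_connected V E ends"
  shows "finite (components (- skeleton V E pos \<gamma>)) \<and>
    card E + 2 \<le> card (components (- skeleton V E pos \<gamma>)) + card V"
proof -
  define euler_bound where "euler_bound W F \<longleftrightarrow>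
    path_connected (skeleton W F pos \<gamma>) \<and> finite (components (- skeleton W F pos \<gamma>)) \<and>
    card F + 2 \<le> card (components (- skeleton W F pos \<gamma>)) + card W" for W F
  have "euler_bound V E"
  proof (rule graph_connected_induct[OF multigraph assms])
    fix v assume "v \<in> V"
    have "pos v + 1 \<in> - {pos v}" by simp
    then have "- {pos v} \<noteq> {}" by blast
    moreover have "connected (- {pos v})" by (rule connected_punctured_universe) simp
    ultimately have "components (- {pos v}) = {- {pos v}}"
      by (metis components_eq_sing_iff)
    then show "euler_bound {v} {}" by (simp add: euler_bound_def skeleton_def)
  next
    fix W F e
    assume step: "W \<subseteq> V" "F \<subseteq> E" "e \<in> E - F" "ends e \<inter> W \<noteq> {}" and IH: "euler_bound W F"
    have "card (insert e F) = Suc (card F)"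
      using step(3) finite_subset[OF step(2) finite_E] by simp
    then show "euler_bound (W \<union> ends e) (insert e F)"
      using card_components_skeleton_insert_edge[OF step] IH by (simp add: euler_bound_def)
  qed
  then show ?thesis by (simp add: euler_bound_def)
qed

lemma card_corners_le_degree:
  assumes v: "v \<in> V" "\<exists>e\<in>E. v \<in> ends e" and U: "open U" "pos v \<in> U"
  shows "finite (corners U (skeleton V E pos \<gamma>) (pos v)) \<and>
    card (corners U (skeleton V E pos \<gamma>) (pos v)) \<le> degree E ends v"
proof -
  define I where "I = {e \<in> E. v \<in> ends e}"
  define B where "B = skeleton (V - {v}) (E - I) pos \<gamma>"
  have I: "finite I" "I \<noteq> {}" using finite_E v(2) by (auto simp: I_def)
  have "\<exists>g. arc g \<and> path_image g = path_image (\<gamma> e) \<and> pathstart g = pos v" if "e \<in> I" for e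
  proof -
    have "e \<in> E" "v \<in> ends e" using that by (simp_all add: I_def)
    then show ?thesis by (rule edge_from) blast
  qed
  then obtain \<delta> where \<delta>: "\<And>e. e \<in> I \<Longrightarrow> arc (\<delta> e)"
    "\<And>e. e \<in> I \<Longrightarrow> path_image (\<delta> e) = path_image (\<gamma> e)"
    "\<And>e. e \<in> I \<Longrightarrow> pathstart (\<delta> e) = pos v"
    by metis
  have "pos v \<notin> B"
    using edge_avoids v(1) inj_onD[OF inj_pos, of v] by (auto simp: B_def I_def skeleton_def)
  moreover have "closed B" unfolding B_def by (rule closed_skeleton) auto
  ultimately have "open (U - B)" "pos v \<in> U - B" using U by auto
  then have "finite (corners (U - B) (\<Union>e\<in>I. path_image (\<delta> e)) (pos v)) \<and>
      card (corners (U - B) (\<Union>e\<in>I. path_image (\<delta> e)) (pos v)) \<le> card I"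
    using \<delta> finite_crossings unfolding I_def[symmetric]
    by (intro card_corners_le_card_arcs I) (auto simp: I_def)
  moreover have "skeleton V E pos \<gamma> = B \<union> (\<Union>e\<in>I. path_image (\<delta> e))"
  proof -
    have "pos v \<in> (\<Union>e\<in>I. path_image (\<gamma> e))"
      using I(2) pos_ends_subset unfolding I_def by blast
    then show ?thesis
      using v(1) \<delta>(2) unfolding B_def skeleton_def I_def by auto
  qed
  then have "corners (U - B) (\<Union>e\<in>I. path_image (\<delta> e)) (pos v) = corners U (skeleton V E pos \<gamma>) (pos v)"
    by (simp add: corners_def Diff_eq Int_assoc)
  ultimately show ?thesis by (simp add: degree_def I_def)
qed

end

section \<open>Charts of the sphere\<close>

lemma components_homeomorphism_image:
  assumes hom: "homeomorphism A B f g"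
  shows "components B = (`) f ` components A"
proof -
  have image_subset: "f ` connected_component_set A x \<subseteq> connected_component_set B (f x)"
    if "homeomorphism A B f g" "x \<in> A" for A B f g and x
  proof (rule connected_component_maximal)
    show "connected (f ` connected_component_set A x)"
      by (rule connected_continuous_image
          [OF continuous_on_subset[OF homeomorphism_cont1[OF that(1)] connected_component_subset]]) simp
    show "f ` connected_component_set A x \<subseteq> B"
      using homeomorphism_image1[OF that(1)] connected_component_subset[of A x] by blast
  qed (use that(2) in simp)
  have "connected_component_set B (f x) = f ` connected_component_set A x" if x: "x \<in> A" for x
  proof
    have fx: "f x \<in> B" "g (f x) = x"
      using homeomorphism_image1[OF hom] homeomorphism_apply1[OF hom] x by auto
    have "g ` connected_component_set B (f x) \<subseteq> connected_component_set A x"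
      using image_subset[OF homeomorphism_symD[OF hom] fx(1)] fx(2) by simp
    moreover have "f (g y) = y" if "y \<in> connected_component_set B (f x)" for y
      using homeomorphism_apply2[OF hom] connected_component_subset that by blast
    ultimately show "connected_component_set B (f x) \<subseteq> f ` connected_component_set A x"
      by (force simp: subset_iff image_iff)
  qed (rule image_subset[OF hom x])
  then show ?thesis
    unfolding components_def homeomorphism_image1[OF hom, symmetric] image_image by simp
qed

lemma homeomorphism_inj_on: "homeomorphism A B f g \<Longrightarrow> inj_on f A"
  using homeomorphism_apply1 by (rule inj_on_inverseI)

lemma card_components_homeomorphism:
  assumes "homeomorphism A B f g"
  shows "finite (components A) \<longleftrightarrow> finite (components B)"
    and "card (components A) = card (components B)"
proof -
  have "inj_on ((`) f) (components A)"
    using homeomorphism_inj_on[OF assms] by (intro inj_on_image) (simp add: Union_components[symmetric])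
  then show "finite (components A) \<longleftrightarrow> finite (components B)" "card (components A) = card (components B)"
    unfolding components_homeomorphism_image[OF assms] by (simp_all add: finite_image_iff card_image)
qed

lemma card_corners_homeomorphism_le:
  fixes f :: "'a::metric_space \<Rightarrow> 'b::metric_space"
  assumes hom: "homeomorphism T T' f g" and sub: "U \<subseteq> T" "D \<subseteq> T" "v \<in> T"
    and fin: "finite (corners (f ` U) (f ` D) (f v))"
  shows "finite (corners U D v) \<and> card (corners U D v) \<le> card (corners (f ` U) (f ` D) (f v))"
proof -
  have inj: "inj_on f T" by (rule homeomorphism_inj_on[OF hom])
  have diff: "f ` (U - D) = f ` U - f ` D" using inj_on_image_set_diff[OF inj] sub by blast
  have hom': "homeomorphism (U - D) (f ` U - f ` D) f g"
    using sub homeomorphism_image1[OF hom] by (intro homeomorphism_of_subsets[OF hom _ _ diff]) auto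
  have "f ` K \<in> corners (f ` U) (f ` D) (f v)" if K: "K \<in> corners U D v" for K
  proof -
    have comp: "K \<in> components (U - D)" and "v \<in> closure K" using K by (auto simp: corners_def)
    then obtain x where x: "\<And>n. x n \<in> K" "x \<longlonglongrightarrow> v" by (auto simp: closure_sequential)
    have "K \<subseteq> T" using in_components_subset[OF comp] sub(1) by blast
    then have "(f \<circ> x) \<longlonglongrightarrow> f v"
      using homeomorphism_cont1[OF hom] x sub(3) unfolding continuous_on_sequentially by blast
    then have "f v \<in> closure (f ` K)"
      unfolding closure_sequential using x(1) by (intro exI[of _ "f \<circ> x"]) auto
    then show ?thesis
      using comp by (simp add: corners_def components_homeomorphism_image[OF hom'])
  qed
  moreover have "inj_on ((`) f) (corners U D v)"
  proof (rule inj_on_image, rule inj_on_subset[OF inj])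
    show "\<Union> (corners U D v) \<subseteq> T"
      using in_components_subset sub(1) by (fastforce simp: corners_def)
  qed
  ultimately show ?thesis
    using fin card_inj_on_le[of "(`) f"] inj_on_finite[of "(`) f"] by (metis image_subsetI)
qed

lemma chart_of_S2:
  assumes "N \<in> S2"
  obtains j k where "homeomorphism (S2 - {N}) (UNIV :: complex set) j k"
proof -
  have "(S2 - {N}) homeomorphic (UNIV :: complex set)"
    using assms by (intro homeomorphic_punctured_sphere_affine) auto
  then show thesis using that unfolding homeomorphic_def by blast
qed

lemma connected_S2_open_delete:
  assumes C: "openin (top_of_set S2) C" "connected C" "C \<noteq> {}" and M: "M \<in> S2" "M \<notin> C"
  shows "connected (C - {N})" "C - {N} \<noteq> {}"
proof -
  obtain j k where jk: "homeomorphism (S2 - {M}) (UNIV :: complex set) j k"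
    using chart_of_S2[OF M(1)] .
  have C_subset: "C \<subseteq> S2 - {M}" using openin_imp_subset[OF C(1)] M(2) by blast
  have hom: "homeomorphism C (j ` C) j k" by (rule homeomorphism_of_subsets[OF jk C_subset]) auto
  have "openin (top_of_set (S2 - {M})) C" by (rule openin_subset_trans[OF C(1) C_subset]) auto
  then have "open (j ` C)" using homeomorphism_imp_open_map[OF jk] by simp
  moreover have "connected (j ` C)"
    by (rule connected_continuous_image[OF homeomorphism_cont1[OF hom] C(2)])
  ultimately have "connected (j ` C - {j N})" by (rule connected_open_delete) simp
  show "C - {N} \<noteq> {}"
  proof
    assume "C - {N} = {}"
    then have "C = {N}" using C(3) by blast
    then show False using \<open>open (j ` C)\<close> by (simp add: not_open_singleton)
  qed
  show "connected (C - {N})"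
  proof (cases "N \<in> C")
    case True
    have "j ` (C - {N}) = j ` C - {j N}"
      using True inj_on_image_set_diff[OF homeomorphism_inj_on[OF hom], of C "{N}"] by simp
    then have "homeomorphism (C - {N}) (j ` C - {j N}) j k"
      by (intro homeomorphism_of_subsets[OF hom]) auto
    then show ?thesis
      using \<open>connected (j ` C - {j N})\<close> connected_continuous_image[OF homeomorphism_cont2]
      by (metis homeomorphism_image2)
  qed (simp add: C(2))
qed

lemma card_components_S2_delete:
  assumes D: "closed D" "M \<in> S2 \<inter> D" and N: "N \<in> S2 - D"
  shows "finite (components (S2 - D - {N})) \<longleftrightarrow> finite (components (S2 - D))"
    and "card (components (S2 - D - {N})) = card (components (S2 - D))"
proof -
  obtain C where C: "C \<in> components (S2 - D)" "{N} \<subseteq> C"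
    using exists_component_superset[of "{N}" "S2 - D"] N
    by (metis connected_sing emptyE empty_subsetI insert_subset)
  have open_complement: "openin (top_of_set S2) (S2 - D)"
    using D(1) by (simp add: Diff_eq openin_open_Int open_Compl)
  then have "locally connected (S2 - D)"
    by (rule locally_open_subset[OF locally_connected_sphere])
  then have "openin (top_of_set (S2 - D)) C"
    using C(1) by (rule openin_components_locally_connected)
  then have "openin (top_of_set S2) C" using open_complement by (rule openin_trans)
  moreover have "M \<in> S2" "M \<notin> C" using D(2) in_components_subset[OF C(1)] by auto
  ultimately have "connected (C - {N})" "C - {N} \<noteq> {}"
    using connected_S2_open_delete in_components_connected[OF C(1)] in_components_nonempty[OF C(1)]
    by simp_all
  then have single: "components (C - {N}) = {C - {N}}"
    by (metis components_eq_sing_iff)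
  then show finite_iff: "finite (components (S2 - D - {N})) \<longleftrightarrow> finite (components (S2 - D))"
    by (intro finite_components_Diff_iff[OF C]) simp
  show "card (components (S2 - D - {N})) = card (components (S2 - D))"
  proof (cases "finite (components (S2 - D))")
    case True
    then show ?thesis using card_components_Diff[OF C] by (simp add: single)
  next
    case False
    then show ?thesis using finite_iff by simp
  qed
qed

lemma interior_of_arc_in_sphere:
  fixes g :: "real \<Rightarrow> 'a::euclidean_space"
  assumes g: "arc g" and r: "r \<noteq> 0" and dim: "3 \<le> DIM('a)"
  shows "top_of_set (sphere a r) interior_of path_image g = {}"
proof -
  let ?U = "top_of_set (sphere a r) interior_of path_image g"
  obtain h where h: "homeomorphism {0..1} (path_image g) g h"
    using homeomorphism_arc[OF g] by blast
  let ?f = "\<lambda>x. complex_of_real (h x)"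
  have U: "?U \<subseteq> path_image g" by (rule interior_of_subset)
  have "openin (top_of_set (UNIV::complex set)) (?f ` ?U)"
  proof (rule invariance_of_domain_sphere_affine_set[OF _ _ _ r])
    show "continuous_on ?U ?f"
      by (intro continuous_intros continuous_on_subset[OF homeomorphism_cont2[OF h] U])
    show "inj_on ?f ?U"
      using homeomorphism_apply2[OF h] U by (intro inj_on_inverseI[of _ "\<lambda>z. g (Re z)"]) auto
    show "openin (top_of_set (sphere a r)) ?U" by (rule openin_interior_of)
  qed (use dim in auto)
  then have "open (?f ` ?U)" by simp
  moreover have "?f ` ?U \<subseteq> {z. \<i> \<bullet> z = 0}" by auto
  ultimately have "?f ` ?U \<subseteq> interior {z. \<i> \<bullet> z = 0}" by (intro interior_maximal)
  moreover have "interior {z. \<i> \<bullet> z = 0} = {}" by (rule interior_hyperplane) simp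
  ultimately show ?thesis by blast
qed

lemma finite_arcs_not_cover_sphere:
  fixes g :: "'i \<Rightarrow> real \<Rightarrow> 'a::euclidean_space"
  assumes I: "finite I"
    and g: "\<And>i. i \<in> I \<Longrightarrow> arc (g i)" "\<And>i. i \<in> I \<Longrightarrow> path_image (g i) \<subseteq> sphere a r"
    and r: "0 < r" and dim: "3 \<le> DIM('a)"
  shows "\<not> sphere a r \<subseteq> (\<Union>i\<in>I. path_image (g i))"
proof
  assume cover: "sphere a r \<subseteq> (\<Union>i\<in>I. path_image (g i))"
  have "top_of_set (sphere a r) interior_of (\<Union>i\<in>I. path_image (g i)) = {}"
    using I g
  proof (induction rule: finite_induct)
    case (insert i I)
    have "closedin (top_of_set (sphere a r)) (path_image (g i))"
      using insert.prems by (intro closed_subset closed_arc_image) auto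
    then show ?case
      using insert interior_of_arc_in_sphere[of "g i" r a] r dim
      by (simp add: interior_of_closedin_union_empty_interior_of)
  qed simp
  moreover have "sphere a r \<subseteq> top_of_set (sphere a r) interior_of (\<Union>i\<in>I. path_image (g i))"
    using cover by (intro interior_of_maximal) auto
  ultimately show False using r by (metis sphere_eq_empty not_less_iff_gr_or_eq subset_empty)
qed

section \<open>Counting cells and corners on the sphere\<close>

lemma drawing_imp_arc_drawing:
  assumes "multigraph V E ends" and drawing: "drawing V E ends pos \<gamma>"
  shows "arc_drawing V E ends pos \<gamma>"
proof
  show "multigraph V E ends" by (rule assms(1))
  show inj: "inj_on pos V" using drawing by (simp add: drawing_def)
  show "finite (path_image (\<gamma> e) \<inter> path_image (\<gamma> f))" if "e \<in> E" "f \<in> E" "e \<noteq> f" for e f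
    using drawing that by (simp add: drawing_def)
  fix e assume e: "e \<in> E"
  show "arc (\<gamma> e)" and ends: "{pathstart (\<gamma> e), pathfinish (\<gamma> e)} = pos ` ends e"
    using drawing e by (simp_all add: drawing_def)
  fix v assume v: "v \<in> V" "pos v \<in> path_image (\<gamma> e)"
  have "interior_pts (\<gamma> e) \<inter> pos ` V = {}" using drawing e by (simp add: drawing_def)
  then have "pos v \<notin> \<gamma> e ` {0<..<1}" using v(1) unfolding interior_pts_def by blast
  moreover obtain t where t: "t \<in> {0..1}" "pos v = \<gamma> e t" using v(2) by (auto simp: path_image_def)
  ultimately have "t = 0 \<or> t = 1" by (cases "t \<in> {0<..<1}") auto
  then have "pos v \<in> pos ` ends e"
    unfolding ends[symmetric] using t(2) by (auto simp: pathstart_def pathfinish_def)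
  moreover have "ends e \<subseteq> V" using assms(1) e by (auto simp: multigraph_def)
  ultimately show "v \<in> ends e" using inj v(1) by (auto dest: inj_onD)
qed

locale sphere_drawing =
  fixes V :: "'v set" and E :: "'e set" and ends and pos and \<gamma>
  assumes graph: "multigraph V E ends" and conn: "graph_connected V E ends" and two: "card V \<ge> 2"
    and drawing: "drawing V E ends pos \<gamma>"

sublocale sphere_drawing \<subseteq> arc_drawing V E ends pos \<gamma>
  by (rule drawing_imp_arc_drawing[OF graph drawing])

context sphere_drawing
begin

abbreviation "drawn \<equiv> drawing_set V E pos \<gamma>"

lemma drawn_eq_skeleton: "drawn = skeleton V E pos \<gamma>"
  by (simp add: skeleton_def drawing_set_def)

lemma closed_drawn: "closed drawn"
  unfolding drawn_eq_skeleton by (rule closed_skeleton) simp_all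

lemma pos_in_drawn: "v \<in> V \<Longrightarrow> pos v \<in> drawn"
  by (simp add: drawing_set_def)

lemma edge_subset_S2: "e \<in> E \<Longrightarrow> path_image (\<gamma> e) \<subseteq> S2"
  using drawing by (simp add: drawing_def)

lemma drawn_eq_Union_edges: "drawn = (\<Union>e\<in>E. path_image (\<gamma> e))"
proof -
  have "pos v \<in> (\<Union>e\<in>E. path_image (\<gamma> e))" if "v \<in> V" for v
    using graph_connected_incident_edge[OF conn two that] pos_ends_subset by blast
  then show ?thesis unfolding drawing_set_def by blast
qed

lemma drawn_subset_S2: "drawn \<subseteq> S2"
  using edge_subset_S2 unfolding drawn_eq_Union_edges by blast

lemma exists_chart_off_drawing:
  obtains N j k where "N \<in> S2 - drawn" "homeomorphism (S2 - {N}) (UNIV :: complex set) j k"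
proof -
  have "\<not> S2 \<subseteq> drawn"
    unfolding drawn_eq_Union_edges
    by (rule finite_arcs_not_cover_sphere[OF finite_E arc_edge edge_subset_S2]) simp_all
  then obtain N where "N \<in> S2 - drawn" by blast
  then show thesis using chart_of_S2[of N] that by blast
qed

end

locale charted_drawing = sphere_drawing +
  fixes N and j :: "real^3 \<Rightarrow> complex" and k
  assumes N_off: "N \<in> S2 - drawn" and chart: "homeomorphism (S2 - {N}) UNIV j k"
begin

lemma drawn_subset_chart: "drawn \<subseteq> S2 - {N}"
  using N_off drawn_subset_S2 by blast

lemma plane_drawing_chart: "plane_drawing V E ends (j \<circ> pos) (\<lambda>e. j \<circ> \<gamma> e)"
  unfolding plane_drawing_def
proof (rule arc_drawing_compose)
  show "continuous_on (skeleton V E pos \<gamma>) j"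
    using continuous_on_subset[OF homeomorphism_cont1[OF chart] drawn_subset_chart]
    by (simp add: drawn_eq_skeleton)
  show "inj_on j (skeleton V E pos \<gamma>)"
    using inj_on_subset[OF homeomorphism_inj_on[OF chart] drawn_subset_chart]
    by (simp add: drawn_eq_skeleton)
qed

lemma skeleton_chart: "skeleton V E (j \<circ> pos) (\<lambda>e. j \<circ> \<gamma> e) = j ` drawn"
  by (simp add: skeleton_compose drawn_eq_skeleton)

lemma card_cells_lower_bound:
  "finite (cells V E pos \<gamma>) \<and> card E + 2 \<le> card (cells V E pos \<gamma>) + card V"
proof -
  have "S2 - drawn - {N} = S2 - {N} - drawn" by auto
  also have "j ` (S2 - {N} - drawn) = - j ` drawn"
    using inj_on_image_set_diff[OF homeomorphism_inj_on[OF chart] Diff_subset drawn_subset_chart]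
      homeomorphism_image1[OF chart] by (simp add: Compl_eq_Diff_UNIV)
  finally have "homeomorphism (S2 - drawn - {N}) (- j ` drawn) j k"
    by (intro homeomorphism_of_subsets[OF chart]) auto
  note chart_components = card_components_homeomorphism[OF this]
  obtain v where "v \<in> V" using conn by (auto simp: graph_connected_def)
  then have "pos v \<in> S2 \<inter> drawn" using pos_in_drawn drawn_subset_S2 by blast
  note delete_components = card_components_S2_delete[OF closed_drawn this N_off]
  have "finite (components (- j ` drawn)) \<and> card E + 2 \<le> card (components (- j ` drawn)) + card V"
    using plane_drawing.card_components_skeleton_lower_bound[OF plane_drawing_chart conn]
    unfolding skeleton_chart .
  then show ?thesis
    unfolding cells_def chart_components[symmetric] delete_components .
qed

abbreviation "corners_near v \<epsilon> \<equiv> corners (S2 \<inter> ball (pos v) \<epsilon>) drawn (pos v)"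

lemma card_corners_near_le_degree:
  assumes v: "v \<in> V" and \<epsilon>: "0 < \<epsilon>" "\<epsilon> < dist (pos v) N"
  shows "finite (corners_near v \<epsilon>) \<and> card (corners_near v \<epsilon>) \<le> degree E ends v"
proof -
  let ?U = "S2 \<inter> ball (pos v) \<epsilon>"
  have U_subset: "?U \<subseteq> S2 - {N}" using \<epsilon>(2) by auto
  have pos_chart: "pos v \<in> S2 - {N}" using drawn_subset_chart pos_in_drawn[OF v] by blast
  have "openin (top_of_set (S2 - {N})) ?U"
    by (rule openin_subset_trans[OF openin_open_Int[OF open_ball] U_subset]) auto
  then have "open (j ` ?U)" using homeomorphism_imp_open_map[OF chart] by simp
  moreover have "j (pos v) \<in> j ` ?U"
    using \<epsilon>(1) pos_chart by simp
  ultimately have "finite (corners (j ` ?U) (j ` drawn) (j (pos v))) \<and>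
      card (corners (j ` ?U) (j ` drawn) (j (pos v))) \<le> degree E ends v"
    by (rule plane_drawing.card_corners_le_degree[OF plane_drawing_chart v
          graph_connected_incident_edge[OF conn two v], unfolded skeleton_chart comp_apply])
  then show ?thesis
    using card_corners_homeomorphism_le[OF chart U_subset drawn_subset_chart pos_chart]
    by (meson order_trans)
qed

lemma eventually_card_corners_near_le_degree:
  assumes "v \<in> V"
  shows "\<forall>\<^sub>F \<epsilon> in at_right 0.
    finite (corners_near v \<epsilon>) \<and> card (corners_near v \<epsilon>) \<le> degree E ends v"
proof -
  have "pos v \<noteq> N" using drawn_subset_chart pos_in_drawn[OF assms] by auto
  then show ?thesis
    unfolding eventually_at_right_field
    using card_corners_near_le_degree[OF assms] by (intro exI[of _ "dist (pos v) N"]) simp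
qed

lemma sum_corners_at_le:
  assumes fin: "finite (corners_near v \<epsilon>)"
  shows "(\<Sum>c\<in>cells V E pos \<gamma>. corners_at V E pos \<gamma> c v \<epsilon>) \<le> card (corners_near v \<epsilon>)"
proof -
  let ?inside = "\<lambda>c. {K \<in> corners_near v \<epsilon>. K \<subseteq> c}"
  have disjoint: "?inside c \<inter> ?inside c' = {}"
    if "c \<in> cells V E pos \<gamma>" "c' \<in> cells V E pos \<gamma>" "c \<noteq> c'" for c c'
  proof -
    have "c \<inter> c' = {}" using that components_nonoverlap unfolding cells_def by metis
    moreover have "K \<noteq> {}" if "K \<in> corners_near v \<epsilon>" for K
      using that in_components_nonempty by (auto simp: corners_def)
    ultimately show ?thesis by fast
  qed
  have "(\<Sum>c\<in>cells V E pos \<gamma>. corners_at V E pos \<gamma> c v \<epsilon>) = (\<Sum>c\<in>cells V E pos \<gamma>. card (?inside c))"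
    by (intro sum.cong refl) (auto simp: corners_at_def corners_def intro: arg_cong[of _ _ card])
  also have "\<dots> = card (\<Union>c\<in>cells V E pos \<gamma>. ?inside c)"
    using fin card_cells_lower_bound disjoint by (intro card_UN_disjoint[symmetric]) auto
  also have "\<dots> \<le> card (corners_near v \<epsilon>)" using fin by (intro card_mono) auto
  finally show ?thesis .
qed

lemma eventually_sum_vertex_incidences_le:
  "\<forall>\<^sub>F \<epsilon> in at_right 0. (\<Sum>c\<in>cells V E pos \<gamma>. vertex_incidences V E pos \<gamma> c \<epsilon>) \<le> 2 * card E"
proof -
  have "\<forall>\<^sub>F \<epsilon> in at_right 0. \<forall>v\<in>V.
      finite (corners_near v \<epsilon>) \<and> card (corners_near v \<epsilon>) \<le> degree E ends v"
    using eventually_card_corners_near_le_degree by (intro eventually_ball_finite finite_V) simp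
  then show ?thesis
  proof eventually_elim
    case (elim \<epsilon>)
    have "(\<Sum>c\<in>cells V E pos \<gamma>. vertex_incidences V E pos \<gamma> c \<epsilon>)
        = (\<Sum>v\<in>V. \<Sum>c\<in>cells V E pos \<gamma>. corners_at V E pos \<gamma> c v \<epsilon>)"
      unfolding vertex_incidences_def by (rule sum.swap)
    also have "\<dots> \<le> (\<Sum>v\<in>V. degree E ends v)"
      using elim sum_corners_at_le by (intro sum_mono) (meson order_trans)
    also have "\<dots> = 2 * card E" by (rule sum_degree[OF graph])
    finally show ?case .
  qed
qed

lemma edge_bound_of_vertex_incidences:
  assumes "\<And>c. c \<in> cells V E pos \<gamma> \<Longrightarrow> \<forall>\<^sub>F \<epsilon> in at_right 0. m \<le> vertex_incidences V E pos \<gamma> c \<epsilon>"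
  shows "m * (card E + 2) \<le> 2 * card E + m * card V"
proof -
  have "\<forall>\<^sub>F \<epsilon> in at_right 0. \<forall>c\<in>cells V E pos \<gamma>. m \<le> vertex_incidences V E pos \<gamma> c \<epsilon>"
    using assms card_cells_lower_bound by (intro eventually_ball_finite) auto
  with eventually_sum_vertex_incidences_le
  have "\<forall>\<^sub>F \<epsilon> in at_right (0::real). m * card (cells V E pos \<gamma>) \<le> 2 * card E"
  proof eventually_elim
    case (elim \<epsilon>)
    then show ?case
      using sum_bounded_below[of "cells V E pos \<gamma>" m "\<lambda>c. vertex_incidences V E pos \<gamma> c \<epsilon>"]
      by (simp add: mult.commute)
  qed
  then have "m * card (cells V E pos \<gamma>) \<le> 2 * card E" by simp
  moreover have "m * (card E + 2) \<le> m * (card (cells V E pos \<gamma>) + card V)"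
    using card_cells_lower_bound by (intro mult_left_mono) auto
  ultimately show ?thesis by (simp add: algebra_simps)
qed

end

theorem theorem30:
  fixes V :: "'v set" and E :: "'e set" and ends :: "'e \<Rightarrow> 'v set" and k n :: nat
  assumes "k \<ge> 3" and "n \<ge> 3"
    and "multigraph V E ends" and "card V = n"
    and "graph_connected V E ends"
    and "kplus_real_face_graph k V E ends"
  shows "real (card E) \<le> real k / (real k - 2) * (real n - 2)"
proof -
  obtain pos \<gamma> where drawing: "drawing V E ends pos \<gamma>"
    and cells: "\<And>c. c \<in> cells V E pos \<gamma> \<Longrightarrow> \<forall>\<^sub>F \<epsilon> in at_right 0. k \<le> vertex_incidences V E pos \<gamma> c \<epsilon>"
    using assms(6) unfolding kplus_real_face_graph_def kplus_real_face_drawing_def by blast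
  interpret sphere_drawing V E ends pos \<gamma>
    using assms(2-5) drawing by unfold_locales simp_all
  obtain N i j where "N \<in> S2 - drawn" "homeomorphism (S2 - {N}) (UNIV :: complex set) i j"
    using exists_chart_off_drawing .
  then interpret charted_drawing V E ends pos \<gamma> N i j by unfold_locales
  have "k * (card E + 2) \<le> 2 * card E + k * n"
    using edge_bound_of_vertex_incidences[OF cells] assms(4) by simp
  then have "real (k * (card E + 2)) \<le> real (2 * card E + k * n)" by (rule of_nat_mono)
  then have "real (card E) * (real k - 2) \<le> real k * (real n - 2)" by (simp add: algebra_simps)
  then show ?thesis using assms(1) by (simp add: field_simps)
qed

end
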